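(* A matrix $A\in M_n(\mathbb{R}_{\max})$ is max-doubly stochastic if and only if $A\otimes x\prec_{\max}x$ for every vector $x\in\mathbb{R}_{\max}^n$.
   Context: Max algebra: $\mathbb{R}_{\max}$ denotes the semiring $(\mathbb{R}_{\ge 0},\oplus,\otimes)$ with $a\oplus b=\max(a,b)$ and $a\otimes b=ab$. $\mathbb{R}_{\max}^n$ is the set of column vectors of length $n$ with entries in $\mathbb{R}_{\ge0}$, and $M_n(\mathbb{R}_{\max})$ is the set of $n\times n$ matrices with entries in $\mathbb{R}_{\ge 0}$. The matrix product is $(A\otimes B)_{i,j}=\max_k a_{i,k}b_{k,j}$ (likewise for matrix-vector products). Let $\mathbf{1}=(1,\dots,1)^T\in\mathbb{R}_{\max}^n$. A matrix $D\in M_n(\mathbb{R}_{\max})$ is max-doubly stochastic if $D\otimes\mathbf{1}=\mathbf{1}$ and $\mathbf{1}^T\otimes D=\mathbf{1}^T$. For $x,y\in\mathbb{R}_{\max}^n$, $x\prec_{\max}y$ means there is a max-doubly stochastic matrix $D$ with $x=D\otimes y$. *)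

theory Defs
  imports "HOL-Analysis.Analysis"
begin

text \<open>Max algebra: the semiring of nonnegative reals with maximum as addition and the usual
  product as multiplication. Its vectors and square matrices are the real ones with nonnegative
  entries, singled out by the following carrier sets.\<close>

definition rmax_vec :: "(real ^ 'n::finite) set"
  where "rmax_vec = {x. \<forall>i. 0 \<le> x $ i}"

definition rmax_mat :: "(real ^ 'n::finite ^ 'n) set"
  where "rmax_mat = {A. \<forall>i j. 0 \<le> A $ i $ j}"

definition max_matrix_vector_mult ::
    "real ^ 'n::finite ^ 'n \<Rightarrow> real ^ 'n \<Rightarrow> real ^ 'n"  (infixr "*v\<^sub>m\<^sub>a\<^sub>x" 70)
  where "A *v\<^sub>m\<^sub>a\<^sub>x x = (\<chi> i. MAX k. A $ i $ k * x $ k)"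

text \<open>As for \<^term>\<open>(v*)\<close>, the vector on the left is read as a row, so there is no explicit
  transposition.\<close>

definition max_vector_matrix_mult ::
    "real ^ 'n::finite \<Rightarrow> real ^ 'n ^ 'n \<Rightarrow> real ^ 'n"  (infixl "v*\<^sub>m\<^sub>a\<^sub>x" 70)
  where "x v*\<^sub>m\<^sub>a\<^sub>x A = (\<chi> j. MAX k. x $ k * A $ k $ j)"

text \<open>The vector \<^term>\<open>1 :: real ^ 'n\<close> below is the all-ones vector.\<close>

definition max_doubly_stochastic :: "real ^ 'n::finite ^ 'n \<Rightarrow> bool"
  where "max_doubly_stochastic D \<longleftrightarrow>
    D \<in> rmax_mat \<and> D *v\<^sub>m\<^sub>a\<^sub>x 1 = 1 \<and> 1 v*\<^sub>m\<^sub>a\<^sub>x D = 1"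

definition max_majorized :: "real ^ 'n::finite \<Rightarrow> real ^ 'n \<Rightarrow> bool"  (infix "\<prec>\<^sub>m\<^sub>a\<^sub>x" 50)
  where "x \<prec>\<^sub>m\<^sub>a\<^sub>x y \<longleftrightarrow> (\<exists>D. max_doubly_stochastic D \<and> x = D *v\<^sub>m\<^sub>a\<^sub>x y)"

end

theory Submission
  imports Defs
begin

text \<open>If \<^term>\<open>A\<close> is max-doubly stochastic, it witnesses the majorization itself.
  Conversely, finitely many test vectors suffice. On the all-ones vector, \<^term>\<open>A\<close> agrees with
  some max-doubly stochastic matrix and hence fixes it, so every row of \<^term>\<open>A\<close> has maximum
  \<open>1\<close>. On the \<open>j\<close>-th unit vector, the agreement says that \<^term>\<open>A\<close> shares its \<open>j\<close>-th column
  with some max-doubly stochastic matrix (which may vary with \<open>j\<close>), so this column has maximum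
  \<open>1\<close> too: the column condition can be checked on each column separately.\<close>

text \<open>Unit vectors extract columns, as in ordinary linear algebra; nonnegativity enters because
  the maximum absorbs the zero terms off position \<open>j\<close> only if the remaining entry is at least
  \<open>0\<close>.\<close>

lemma max_matrix_vector_mult_axis:
  fixes A :: "real ^ 'n::finite ^ 'n"
  assumes "A \<in> rmax_mat"
  shows "(A *v\<^sub>m\<^sub>a\<^sub>x axis j 1) $ i = A $ i $ j"
proof -
  have "(MAX k. A $ i $ k * axis j 1 $ k) = A $ i $ j"
  proof (rule Max_eqI)
    show "y \<le> A $ i $ j" if "y \<in> range (\<lambda>k. A $ i $ k * axis j 1 $ k)" for y
      using that assms by (auto simp: axis_def rmax_mat_def)
    show "A $ i $ j \<in> range (\<lambda>k. A $ i $ k * axis j 1 $ k)"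
      by (rule range_eqI[of _ _ j]) (simp add: axis_def)
  qed simp
  then show ?thesis
    by (simp add: max_matrix_vector_mult_def)
qed

theorem theorem3p7:
  fixes A :: "real ^ 'n::finite ^ 'n"
  assumes "A \<in> rmax_mat"
  shows "max_doubly_stochastic A \<longleftrightarrow> (\<forall>x \<in> rmax_vec. A *v\<^sub>m\<^sub>a\<^sub>x x \<prec>\<^sub>m\<^sub>a\<^sub>x x)"
proof
  assume "max_doubly_stochastic A"
  then show "\<forall>x \<in> rmax_vec. A *v\<^sub>m\<^sub>a\<^sub>x x \<prec>\<^sub>m\<^sub>a\<^sub>x x"
    by (auto simp: max_majorized_def)
next
  assume major: "\<forall>x \<in> rmax_vec. A *v\<^sub>m\<^sub>a\<^sub>x x \<prec>\<^sub>m\<^sub>a\<^sub>x x"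
  have "(1 :: real ^ 'n) \<in> rmax_vec"
    by (simp add: rmax_vec_def)
  with major have rows: "A *v\<^sub>m\<^sub>a\<^sub>x 1 = 1"
    by (auto simp: max_majorized_def max_doubly_stochastic_def)
  have "(1 v*\<^sub>m\<^sub>a\<^sub>x A) $ j = 1" for j
  proof -
    have "(axis j 1 :: real ^ 'n) \<in> rmax_vec"
      by (simp add: rmax_vec_def axis_def)
    with major obtain D where D: "max_doubly_stochastic D"
      and eq: "A *v\<^sub>m\<^sub>a\<^sub>x axis j 1 = D *v\<^sub>m\<^sub>a\<^sub>x axis j 1"
      by (auto simp: max_majorized_def)
    have "D \<in> rmax_mat" and colD: "1 v*\<^sub>m\<^sub>a\<^sub>x D = 1"
      using D by (auto simp: max_doubly_stochastic_def)
    then have "A $ i $ j = D $ i $ j" for i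
      using eq assms by (metis max_matrix_vector_mult_axis)
    then have "(1 v*\<^sub>m\<^sub>a\<^sub>x A) $ j = (1 v*\<^sub>m\<^sub>a\<^sub>x D) $ j"
      by (simp add: max_vector_matrix_mult_def)
    with colD show ?thesis
      by simp
  qed
  then have "1 v*\<^sub>m\<^sub>a\<^sub>x A = 1"
    by (simp add: vec_eq_iff)
  with rows assms show "max_doubly_stochastic A"
    by (simp add: max_doubly_stochastic_def)
qed

end
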